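(* Let $k \geq 2$ be an integer. Every $k$-connected graph $G$ of order $n \geq 6k+12-2\left\lceil \frac{k-2}{k} \right\rceil$ with $\delta(G) \geq \frac{n}{2}$ contains a Hamiltonian cycle $H$ such that $G-E(H)$ is $k$-connected.
   Context: All graphs are finite, simple and undirected. $\delta(G)$ denotes the minimum degree of $G$. For $F \subseteq E(G)$, $G-F$ is the graph obtained from $G$ by deleting the edges in $F$ (keeping all vertices). A graph is $k$-connected if its vertex connectivity $\kappa(G)$ is at least $k$. *)

theory Defs
  imports Complex_Main "Graph_Theory.Graph_Theory"
begin

text \<open>
  A finite simple undirected graph is a \<^locale>\<open>pair_graph\<close>: a finite, loop-free, symmetric
  set of ordered pairs, so the undirected edge \<open>uv\<close> is present as both \<open>(u,v)\<close> and \<open>(v,u)\<close>.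
\<close>

text \<open>In a symmetric digraph the out-degree is the number of neighbours.\<close>

definition min_degree :: "'a pair_pre_digraph \<Rightarrow> nat" where
  "min_degree G = Min (out_degree (with_proj G) ` pverts G)"

text \<open>
  The least size of a vertex set whose removal leaves a disconnected graph or at most one
  vertex; in particular the complete graph on \<open>n \<ge> 1\<close> vertices has connectivity \<open>n - 1\<close>.
\<close>

definition vertex_connectivity :: "'a pair_pre_digraph \<Rightarrow> nat" where
  "vertex_connectivity G =
     (LEAST k. \<exists>S \<subseteq> pverts G. card S = k \<and>
        (\<not> connected (with_proj G \<restriction> (pverts G - S)) \<or> card (pverts G - S) \<le> 1))"

definition k_connected :: "nat \<Rightarrow> 'a pair_pre_digraph \<Rightarrow> bool" where
  "k_connected k G \<longleftrightarrow> k \<le> vertex_connectivity G"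

definition undirected_edges :: "('a \<times> 'a) set \<Rightarrow> 'a set set" where
  "undirected_edges A = (\<lambda>(u, v). {u, v}) ` A"

definition delete_edges :: "'a pair_pre_digraph \<Rightarrow> 'a set set \<Rightarrow> 'a pair_pre_digraph" where
  "delete_edges G F = \<lparr>pverts = pverts G, parcs = {(u, v) \<in> parcs G. {u, v} \<notin> F}\<rparr>"

text \<open>
  The library's notion of cycle for symmetric digraphs also admits \<open>u, v, u\<close>; the length
  condition excludes it. The vertices of a closed walk are the tails of its arcs.
\<close>

definition hamiltonian_cycle :: "'a pair_pre_digraph \<Rightarrow> ('a \<times> 'a) list \<Rightarrow> bool" where
  "hamiltonian_cycle G p \<longleftrightarrow>
     pre_digraph.cycle (with_proj G) p \<and> 3 \<le> length p \<and> fst ` set p = pverts G"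

end

theory Submission
  imports Defs
begin

text \<open>
  If deleting a Hamiltonian cycle given by Dirac's theorem destroys \<open>k\<close>-connectivity, then fewer
  than \<open>k\<close> vertices \<open>S\<close> split \<open>V - S\<close> into parts \<open>A\<close>, \<open>B\<close> such that every vertex has at most two
  neighbours in the opposite part. The degree condition forces both parts to have about \<open>n / 2\<close>
  vertices and to be almost complete. Assign each vertex of \<open>S\<close> to the part in which it has more
  neighbours; this gives a bipartition \<open>V = X \<union> Y\<close> in which both sides are Hamiltonian-connected
  (Ore closure) and stay \<open>k\<close>-connected after the loss of two edges at each vertex.
  Since \<open>G\<close> is \<open>k\<close>-connected, Koenig's theorem yields a matching of \<open>k\<close> edges between \<open>X\<close> and \<open>Y\<close>.
  By the degree condition two further disjoint edges join \<open>X\<close> and \<open>Y\<close>, and the Hamiltonian cycle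
  that crosses between \<open>X\<close> and \<open>Y\<close> only in these two edges leaves the matching intact.
\<close>

section \<open>Separations and cycles as vertex lists\<close>

definition nbrs :: "('a \<times> 'a) set \<Rightarrow> 'a set \<Rightarrow> 'a \<Rightarrow> 'a set" where
  "nbrs E X u = {v \<in> X. (u, v) \<in> E}"

text \<open>The start vertex is not repeated, so the closing edge is a separate conjunct. An edge
  run back and forth also qualifies; later lemmas exclude this by a bound of at least three
  vertices.\<close>

definition ham_cycle :: "('a \<times> 'a) set \<Rightarrow> 'a set \<Rightarrow> 'a list \<Rightarrow> bool" where
  "ham_cycle E X xs \<longleftrightarrow> distinct xs \<and> set xs = X \<and> xs \<noteq> [] \<and>
     successively (\<lambda>u v. (u, v) \<in> E) xs \<and> (last xs, hd xs) \<in> E"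

definition cycle_arcs :: "'a list \<Rightarrow> ('a \<times> 'a) list" where
  "cycle_arcs xs = zip xs (rotate1 xs)"

text \<open>This is \<open>k\<close>-connectivity in terms of separations: the deleted set is
  whatever lies outside \<open>P \<union> Q\<close>. Naming the two sides instead of the cut makes
  it easy to restrict a separation to a subset of the vertices.\<close>

definition no_small_cut :: "nat \<Rightarrow> 'a set \<Rightarrow> ('a \<times> 'a) set \<Rightarrow> bool" where
  "no_small_cut k V E \<longleftrightarrow> (\<forall>P Q. P \<noteq> {} \<longrightarrow> Q \<noteq> {} \<longrightarrow> P \<inter> Q = {} \<longrightarrow> P \<union> Q \<subseteq> V \<longrightarrow>
     card (V - (P \<union> Q)) < k \<longrightarrow> (\<exists>u\<in>P. \<exists>v\<in>Q. (u, v) \<in> E))"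

text \<open>No arc inside \<open>W\<close> leaves the set of vertices reachable from
  \<open>u\<close>, so if this set misses a vertex, it and its complement violate the partition
  condition. Conversely, a walk from \<open>P\<close> to \<open>Q\<close> must use an arc between
  them.\<close>

lemma connected_induce_iff:
  assumes "sym (parcs G)"
  shows "connected (with_proj G \<restriction> W) \<longleftrightarrow> W \<noteq> {} \<and>
    (\<forall>P Q. P \<noteq> {} \<longrightarrow> Q \<noteq> {} \<longrightarrow> P \<inter> Q = {} \<longrightarrow> P \<union> Q = W \<longrightarrow> (\<exists>u\<in>P. \<exists>v\<in>Q. (u, v) \<in> parcs G))"
proof -
  define R where "R = {(u, v) \<in> parcs G. u \<in> W \<and> v \<in> W}"
  have "parcs (mk_symmetric (with_proj G \<restriction> W)) = R"
    using assms by (auto simp: mk_symmetric_def R_def induce_subgraph_def sym_def)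
  then have conn: "connected (with_proj G \<restriction> W) \<longleftrightarrow>
      W \<noteq> {} \<and> (\<forall>u\<in>W. \<forall>v\<in>W. (u, v) \<in> rtrancl_on W R)"
    by (simp add: connected_def strongly_connected_def reachable_def mk_symmetric_def)
  have reach: "(\<forall>u\<in>W. \<forall>v\<in>W. (u, v) \<in> rtrancl_on W R) \<longleftrightarrow>
    (\<forall>P Q. P \<noteq> {} \<longrightarrow> Q \<noteq> {} \<longrightarrow> P \<inter> Q = {} \<longrightarrow> P \<union> Q = W \<longrightarrow> (\<exists>u\<in>P. \<exists>v\<in>Q. (u, v) \<in> parcs G))"
    (is "?L \<longleftrightarrow> ?R")
  proof
    assume L: ?L
    show ?R
    proof (intro allI impI, rule ccontr)
      fix P Q :: "'a set"
      assume PQ: "P \<noteq> {}" "Q \<noteq> {}" "P \<inter> Q = {}" "P \<union> Q = W"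
        and no: "\<not> (\<exists>u\<in>P. \<exists>v\<in>Q. (u, v) \<in> parcs G)"
      obtain p q where pq: "p \<in> P" "q \<in> Q" using PQ by blast
      have "(p, q) \<in> rtrancl_on W R" using L PQ pq by auto
      then have "q \<in> P"
        by (induction rule: rtrancl_on_induct) (use pq no PQ in \<open>auto simp: R_def\<close>)
      then show False using PQ pq by blast
    qed
  next
    assume R: ?R
    show ?L
    proof (intro ballI, rule ccontr)
      fix u v assume uv: "u \<in> W" "v \<in> W" "(u, v) \<notin> rtrancl_on W R"
      define P where "P = {w \<in> W. (u, w) \<in> rtrancl_on W R}"
      have "u \<in> P" using uv by (auto simp: P_def)
      moreover have "v \<in> W - P" using uv by (auto simp: P_def)
      moreover have "P \<inter> (W - P) = {}" "P \<union> (W - P) = W" by (auto simp: P_def)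
      ultimately obtain a b where ab: "a \<in> P" "b \<in> W - P" "(a, b) \<in> parcs G"
        using R by (metis empty_iff)
      then have "(u, b) \<in> rtrancl_on W R"
        by (auto simp: P_def R_def intro: rtrancl_on_into_rtrancl_on)
      then show False using ab by (auto simp: P_def)
    qed
  qed
  show ?thesis using conn reach by blast
qed

text \<open>Since \<open>k < card (pverts G)\<close>, deleting fewer than \<open>k\<close> vertices
  leaves at least two. The size clause in \<open>vertex_connectivity\<close> is then never met, and
  only connectedness remains to be compared.\<close>

lemma k_connected_iff_no_small_cut:
  assumes "finite (pverts G)" "sym (parcs G)" "k < card (pverts G)"
  shows "k_connected k G \<longleftrightarrow> no_small_cut k (pverts G) (parcs G)"
proof -
  let ?V = "pverts G"
  let ?cut = "\<lambda>S. \<not> connected (with_proj G \<restriction> (?V - S)) \<or> card (?V - S) \<le> 1"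
  \<comment> \<open>Deleting all vertices always counts as a cut, so the \<open>LEAST\<close> is
    attained.\<close>
  have "?V \<subseteq> ?V \<and> card ?V = card ?V \<and> ?cut ?V" by simp
  then have ex: "\<exists>j. \<exists>S \<subseteq> ?V. card S = j \<and> ?cut S" by blast
  have least: "k \<le> (LEAST j. \<exists>S \<subseteq> ?V. card S = j \<and> ?cut S) \<longleftrightarrow>
      (\<forall>S \<subseteq> ?V. card S < k \<longrightarrow> \<not> ?cut S)" (is "k \<le> Least ?j \<longleftrightarrow> ?R")
  proof
    assume k: "k \<le> Least ?j"
    show ?R
    proof (intro allI impI notI)
      fix S assume "S \<subseteq> ?V" "card S < k" "?cut S"
      then have "?j (card S)" by (intro exI[of _ S]) simp
      then have "Least ?j \<le> card S" by (rule Least_le)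
      then show False using k \<open>card S < k\<close> by simp
    qed
  next
    assume R: ?R
    have "?j (Least ?j)" by (rule LeastI_ex[OF ex])
    then obtain S where "S \<subseteq> ?V" "card S = Least ?j" "?cut S" by (elim exE conjE) metis
    then show "k \<le> Least ?j" using R by (metis not_le)
  qed
  have "k_connected k G \<longleftrightarrow> (\<forall>S \<subseteq> ?V. card S < k \<longrightarrow> \<not> ?cut S)"
    unfolding k_connected_def vertex_connectivity_def
    by (rule least)
  also have "\<dots> \<longleftrightarrow> (\<forall>S \<subseteq> ?V. card S < k \<longrightarrow> connected (with_proj G \<restriction> (?V - S)))"
  proof -
    have "card (?V - S) > 1" if "S \<subseteq> ?V" "card S < k" for S
      using that assms by (simp add: card_Diff_subset finite_subset)
    then show ?thesis by (meson not_le)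
  qed
  also have "\<dots> \<longleftrightarrow> no_small_cut k ?V (parcs G)"
  proof
    assume *: "\<forall>S \<subseteq> ?V. card S < k \<longrightarrow> connected (with_proj G \<restriction> (?V - S))"
    show "no_small_cut k ?V (parcs G)"
      unfolding no_small_cut_def
    proof (intro allI impI)
      fix P Q assume PQ: "P \<noteq> {}" "Q \<noteq> {}" "P \<inter> Q = {}" "P \<union> Q \<subseteq> ?V" "card (?V - (P \<union> Q)) < k"
      have "connected (with_proj G \<restriction> (?V - (?V - (P \<union> Q))))"
        using * PQ by blast
      moreover have "?V - (?V - (P \<union> Q)) = P \<union> Q" using PQ by blast
      ultimately show "\<exists>u\<in>P. \<exists>v\<in>Q. (u, v) \<in> parcs G"
        using PQ connected_induce_iff[OF assms(2)] by metis
    qed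
  next
    assume *: "no_small_cut k ?V (parcs G)"
    show "\<forall>S \<subseteq> ?V. card S < k \<longrightarrow> connected (with_proj G \<restriction> (?V - S))"
    proof (intro allI impI)
      fix S assume S: "S \<subseteq> ?V" "card S < k"
      have "card (?V - S) > 0"
        using S assms by (simp add: card_Diff_subset finite_subset)
      then have "?V - S \<noteq> {}" by force
      moreover have "\<exists>u\<in>P. \<exists>v\<in>Q. (u, v) \<in> parcs G"
        if "P \<noteq> {}" "Q \<noteq> {}" "P \<inter> Q = {}" "P \<union> Q = ?V - S" for P Q
      proof -
        have "?V - (P \<union> Q) = S" "P \<union> Q \<subseteq> ?V" using that S by blast+
        then show ?thesis
          using *[unfolded no_small_cut_def, rule_format, of P Q] that(1-3) S(2) by simp
      qed
      ultimately show "connected (with_proj G \<restriction> (?V - S))"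
        by (simp add: connected_induce_iff[OF assms(2)])
    qed
  qed
  finally show ?thesis .
qed

section \<open>Vertex lists as cycles of the digraph\<close>

lemma walk_along_list:
  assumes "xs \<noteq> []"
  shows "pcas (hd xs) (zip xs (tl xs @ [w])) w"
    and "pawalk_verts (hd xs) (zip xs (tl xs @ [w])) = xs @ [w]"
  using assms
proof (induction xs)
  case (Cons x xs)
  { case 1 then show ?case using Cons.IH by (cases xs) auto }
  { case 2 then show ?case using Cons.IH by (cases xs) auto }
qed auto

lemma arcs_along_list:
  assumes "xs \<noteq> []" "successively (\<lambda>u v. (u, v) \<in> E) xs" "(last xs, w) \<in> E"
  shows "set (zip xs (tl xs @ [w])) \<subseteq> E"
  using assms
proof (induction xs)
  case (Cons x xs)
  then show ?case by (cases xs) auto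
qed auto

lemma hamiltonian_cycle_cycle_arcs:
  assumes "ham_cycle (parcs G) (pverts G) xs" "3 \<le> card (pverts G)"
  shows "hamiltonian_cycle G (cycle_arcs xs)"
proof -
  have xs: "distinct xs" "set xs = pverts G" "xs \<noteq> []" "length xs \<ge> 3"
    "successively (\<lambda>u v. (u, v) \<in> parcs G) xs" "(last xs, hd xs) \<in> parcs G"
    using assms distinct_card[of xs] by (auto simp: ham_cycle_def)
  have eq: "cycle_arcs xs = zip xs (tl xs @ [hd xs])"
    using xs(3) by (cases xs) (auto simp: cycle_arcs_def)
  have "pre_digraph.awalk (with_proj G) (hd xs) (cycle_arcs xs) (hd xs)"
    using xs walk_along_list(1)[of xs "hd xs"] arcs_along_list[of xs "parcs G" "hd xs"]
    by (auto simp: eq pre_digraph.awalk_def cas_with_proj_eq dest: hd_in_set)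
  moreover have "distinct (tl (xs @ [hd xs]))"
    using xs by (cases xs) auto
  ultimately have "pre_digraph.cycle (with_proj G) (cycle_arcs xs)"
    using xs walk_along_list(2)[of xs "hd xs"]
    by (auto simp: pre_digraph.cycle_def eq awalk_verts_with_proj_eq intro!: exI[of _ "hd xs"])
  moreover have "map fst (cycle_arcs xs) = xs"
    by (simp add: cycle_arcs_def)
  then have "fst ` set (cycle_arcs xs) = pverts G"
    using xs(2) by (metis set_map)
  moreover have "length (cycle_arcs xs) \<ge> 3" using xs by (simp add: cycle_arcs_def)
  ultimately show ?thesis by (simp add: hamiltonian_cycle_def)
qed

text \<open>The tails of the arcs form \<open>xs\<close> and the heads form a rotation of
  \<open>xs\<close>, both without repetition. So \<open>u\<close> is the tail of at most one arc and
  the head of at most one.\<close>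

lemma card_cycle_arcs_nbrs:
  assumes "distinct xs"
  shows "card {v. (u, v) \<in> set (cycle_arcs xs) \<union> (set (cycle_arcs xs))\<inverse>} \<le> 2"
proof -
  let ?p = "cycle_arcs xs"
  have "distinct (map fst ?p)" "distinct (map snd ?p)"
    using assms by (simp_all add: cycle_arcs_def)
  then have inj: "inj_on fst (set ?p)" "inj_on snd (set ?p)" by (simp_all add: distinct_map)
  have le1: "card B \<le> 1" if "\<And>a b. a \<in> B \<Longrightarrow> b \<in> B \<Longrightarrow> a = b" for B :: "'b set"
  proof (cases "B = {}")
    case False
    then obtain a where "a \<in> B" by blast
    then have "B \<subseteq> {a}" using that by blast
    then show ?thesis using card_mono[of "{a}" B] by simp
  qed simp
  have "card {v. (u, v) \<in> set ?p} \<le> 1"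
    by (rule le1) (use inj_onD[OF inj(1), of "(u, _)" "(u, _)"] in auto)
  moreover have "card {v. (v, u) \<in> set ?p} \<le> 1"
    by (rule le1) (use inj_onD[OF inj(2), of "(_, u)" "(_, u)"] in auto)
  moreover have "{v. (u, v) \<in> set ?p \<union> (set ?p)\<inverse>} = {v. (u, v) \<in> set ?p} \<union> {v. (v, u) \<in> set ?p}"
    by auto
  ultimately show ?thesis by (metis (no_types, lifting) card_Un_le add_mono le_trans one_add_one)
qed

section \<open>Closure under edges of large degree sum\<close>

definition ham_path :: "('a \<times> 'a) set \<Rightarrow> 'a set \<Rightarrow> 'a \<Rightarrow> 'a \<Rightarrow> 'a list \<Rightarrow> bool" where
  "ham_path E X p q xs \<longleftrightarrow> distinct xs \<and> set xs = X \<and> xs \<noteq> [] \<and> hd xs = p \<and> last xs = q \<and>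
     successively (\<lambda>u v. (u, v) \<in> E) xs"

lemma not_successivelyE:
  assumes "\<not> successively R xs"
  obtains as u v bs where "xs = as @ u # v # bs" "\<not> R u v"
proof -
  have "\<exists>as u v bs. xs = as @ u # v # bs \<and> \<not> R u v"
    using assms
  proof (induction R xs rule: successively.induct)
    case (3 R x y xs)
    show ?case
    proof (cases "R x y")
      case True
      then obtain as u v bs where "y # xs = as @ u # v # bs" "\<not> R u v" using 3 by auto
      then show ?thesis by (metis append_Cons)
    qed (metis append_Nil)
  qed auto
  then show ?thesis using that by blast
qed

text \<open>The counting behind Ore's argument: the successors of members of \<open>P\<close> and
  the members of \<open>Q\<close> other than the head are disjoint subsets of the tail of
  \<open>L\<close>. The two corrections account for a last element without successor and for a head
  in \<open>Q\<close>.\<close>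

lemma card_Int_sum_le_length:
  assumes "distinct L" "L \<noteq> []" "successively (\<lambda>w w'. \<not> (w \<in> P \<and> w' \<in> Q)) L"
  shows "card (P \<inter> set L) + card (Q \<inter> set L) + 1 \<le>
    length L + (if last L \<in> P then 1 else 0) + (if hd L \<in> Q then 1 else 0)"
  using assms
proof (induction L)
  case (Cons x L)
  have ins: "card (Z \<inter> set (x # L)) = card (Z \<inter> set L) + (if x \<in> Z then 1 else 0)" for Z
    using Cons.prems(1) by (auto simp: Int_insert_right)
  show ?case
  proof (cases "L = []")
    case True
    then show ?thesis by (auto simp: Int_insert_right)
  next
    case False
    then show ?thesis using Cons ins[of P] ins[of Q] by (auto simp: successively_Cons split: if_splits)
  qed
qed auto

lemma successively_remove_pair:
  assumes "successively (\<lambda>a b. (a, b) \<in> insert (u, v) (insert (v, u) E)) L"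
    and "u \<notin> set L \<or> v \<notin> set L"
  shows "successively (\<lambda>a b. (a, b) \<in> E) L"
  using assms by (elim successively_mono) auto

lemma successively_rev_sym:
  assumes "sym E"
  shows "successively (\<lambda>a b. (a, b) \<in> E) (rev xs) \<longleftrightarrow> successively (\<lambda>a b. (a, b) \<in> E) xs"
  using assms by (auto intro!: arg_cong2[of _ _ _ _ successively] dest: symD)

lemma successively_reverse_segment:
  assumes "sym E" "successively (\<lambda>a b. (a, b) \<in> E) A" "successively (\<lambda>a b. (a, b) \<in> E) B"
    "successively (\<lambda>a b. (a, b) \<in> E) C" "B \<noteq> []" "(last A, last B) \<in> E" "C \<noteq> [] \<Longrightarrow> (hd B, hd C) \<in> E"
  shows "successively (\<lambda>a b. (a, b) \<in> E) (A @ rev B @ C)"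
  using assms successively_rev_sym[of E B]
  by (cases "C = []") (simp_all add: successively_append_iff hd_rev last_rev hd_append del: successively_rev)

lemma in_nbrs_iff [simp]: "v \<in> nbrs E X u \<longleftrightarrow> v \<in> X \<and> (u, v) \<in> E"
  by (simp add: nbrs_def)

lemma nbrs_subset: "nbrs E X u \<subseteq> X"
  by auto

lemma finite_nbrs [simp]: "finite X \<Longrightarrow> finite (nbrs E X u)"
  by (simp add: nbrs_def)

text \<open>Ore's crossing argument: the degree sum forces consecutive \<open>w\<close>,
  \<open>w'\<close> on the path with \<open>w\<close> adjacent to \<open>u\<close> and
  \<open>w'\<close> adjacent to \<open>v\<close>. Running from \<open>v\<close> to \<open>w\<close>,
  jumping to \<open>u\<close>, going back to \<open>w'\<close> and closing at \<open>v\<close> gives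
  the cycle.\<close>

lemma ham_cycle_of_path:
  assumes E: "sym E" "irrefl E" and path: "ham_path E X v u xs" and "u \<noteq> v" "(u, v) \<notin> E"
    and deg: "card X \<le> card (nbrs E X u) + card (nbrs E X v)"
  shows "\<exists>ys. ham_cycle E X ys"
proof -
  note xs = path[unfolded ham_path_def]
  have "\<not> successively (\<lambda>w w'. \<not> (w \<in> nbrs E X u \<and> w' \<in> nbrs E X v)) xs"
  proof
    assume "successively (\<lambda>w w'. \<not> (w \<in> nbrs E X u \<and> w' \<in> nbrs E X v)) xs"
    from card_Int_sum_le_length[OF _ _ this] have "card (nbrs E X u) + card (nbrs E X v) + 1 \<le> card X"
      using xs E nbrs_subset[of E X] distinct_card[of xs]
      by (auto simp: irrefl_def Int_absorb2 split: if_splits)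
    then show False using deg by simp
  qed
  then obtain as w w' bs where dec: "xs = as @ w # w' # bs" "(u, w) \<in> E" "(v, w') \<in> E"
    by (elim not_successivelyE) auto
  have "ham_cycle E X ((as @ [w]) @ rev (w' # bs))"
  proof -
    have "successively (\<lambda>a b. (a, b) \<in> E) (as @ [w])" "successively (\<lambda>a b. (a, b) \<in> E) (w' # bs)"
      using xs dec by (simp_all add: successively_append_iff)
    moreover have ends: "last (w' # bs) = u" "hd (as @ w # w' # bs) = v"
      using xs dec by auto
    moreover have "(w, u) \<in> E" "(w', v) \<in> E" using dec E(1) by (auto dest: symD)
    moreover have "distinct ((as @ [w]) @ rev (w' # bs))" "set ((as @ [w]) @ rev (w' # bs)) = X"
      using xs dec(1) by auto
    ultimately show ?thesis
      using successively_reverse_segment[OF E(1), of "as @ [w]" "w' # bs" "[]"] unfolding ham_cycle_def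
      by (auto simp: hd_append)
  qed
  then show ?thesis by blast
qed

text \<open>One step of the Bondy-Chvatal closure. If the given cycle uses the new edge, deleting
  that edge leaves a Hamiltonian path between its ends, to which Ore's argument applies.\<close>

lemma ham_cycle_closure_step:
  assumes E: "sym E" "irrefl E" and "u \<noteq> v" "(u, v) \<notin> E" and X: "3 \<le> card X"
    and deg: "card X \<le> card (nbrs E X u) + card (nbrs E X v)"
    and cyc: "ham_cycle (insert (u, v) (insert (v, u) E)) X xs"
  shows "\<exists>ys. ham_cycle E X ys"
proof -
  note xs = cyc[unfolded ham_cycle_def]
  have close: "\<exists>ys. ham_cycle E X ys"
    if "ham_path E X a b ys" "(a = u \<and> b = v) \<or> (a = v \<and> b = u)" for a b ys
  proof -
    have "b \<noteq> a" "(b, a) \<notin> E" "card X \<le> card (nbrs E X b) + card (nbrs E X a)"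
      using that(2) assms by (auto simp: sym_def)
    then show ?thesis by (rule ham_cycle_of_path[OF E that(1)])
  qed
  consider (inner) "\<not> successively (\<lambda>a b. (a, b) \<in> E) xs"
    | (wrap) "successively (\<lambda>a b. (a, b) \<in> E) xs" "(last xs, hd xs) \<notin> E"
    | (none) "ham_cycle E X xs"
    using xs by (auto simp: ham_cycle_def)
  then show ?thesis
  proof cases
    case inner
    then obtain as a b bs where dec: "xs = as @ a # b # bs" "(a, b) \<notin> E" by (rule not_successivelyE)
    have ab: "(a = u \<and> b = v) \<or> (a = v \<and> b = u)"
      using xs dec by (auto simp: successively_append_iff)
    have "successively (\<lambda>a b. (a, b) \<in> E) (as @ [a])" "successively (\<lambda>a b. (a, b) \<in> E) (b # bs)"
      by (rule successively_remove_pair[of u v];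
          use xs dec ab in \<open>auto simp: successively_append_iff successively_Cons\<close>)+
    moreover have "(last (b # bs), hd (as @ [a])) \<in> E"
    proof -
      \<comment> \<open>A third vertex guarantees that the closing arc is not the new edge once
        more.\<close>
      have "as \<noteq> [] \<or> bs \<noteq> []"
        using X xs dec distinct_card[of xs] by auto
      then show ?thesis
      proof
        assume "as \<noteq> []"
        then have "hd xs = hd as" "hd as \<notin> {a, b}" "last xs = last (b # bs)" "last (b # bs) \<noteq> a"
          using xs dec(1) last_in_set[of "b # bs"] hd_in_set[of as] by auto
        then show ?thesis using xs ab \<open>as \<noteq> []\<close> by auto
      next
        assume "bs \<noteq> []"
        then have "hd xs = hd (as @ [a])" "last bs \<notin> {a, b}" "last xs = last bs"
          using xs dec(1) last_in_set[of bs] by (auto simp: hd_append)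
        then show ?thesis using xs ab \<open>bs \<noteq> []\<close> by auto
      qed
    qed
    ultimately have "ham_path E X b a ((b # bs) @ as @ [a])"
    proof -
      assume s: "successively (\<lambda>a b. (a, b) \<in> E) (as @ [a])" "successively (\<lambda>a b. (a, b) \<in> E) (b # bs)"
        "(last (b # bs), hd (as @ [a])) \<in> E"
      have "successively (\<lambda>a b. (a, b) \<in> E) ((b # bs) @ as @ [a])"
        unfolding successively_append_iff[of _ "b # bs"] using s by blast
      moreover have "distinct ((b # bs) @ as @ [a])" "set ((b # bs) @ as @ [a]) = X"
        using xs dec(1) by auto
      ultimately show ?thesis unfolding ham_path_def by simp
    qed
    then show ?thesis by (rule close) (use ab in blast)
  next
    case wrap
    then have "ham_path E X (hd xs) (last xs) xs" using xs by (simp add: ham_path_def)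
    then show ?thesis by (rule close) (use xs wrap in auto)
  next
    case none
    then show ?thesis ..
  qed
qed

text \<open>The closure step with prescribed ends. Deleting the new edge \<open>ab\<close> cuts the
  path into two segments, and the count bounds the neighbours of \<open>a\<close> and
  \<open>b\<close> in each segment only by its length. Hence the degree sum must exceed
  \<open>card X\<close> by at least one to force a crossing pair inside a segment.\<close>

lemma ham_path_closure_step:
  assumes E: "sym E" "irrefl E" and uv: "u \<noteq> v" "(u, v) \<notin> E"
    and deg: "card X < card (nbrs E X u) + card (nbrs E X v)"
    and path: "ham_path (insert (u, v) (insert (v, u) E)) X p q xs"
  shows "\<exists>ys. ham_path E X p q ys"
proof (cases "successively (\<lambda>a b. (a, b) \<in> E) xs")
  case True
  then show ?thesis using path by (auto simp: ham_path_def)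
next
  case False
  note xs = path[unfolded ham_path_def]
  obtain as a b bs where dec: "xs = as @ a # b # bs" "(a, b) \<notin> E"
    using False by (rule not_successivelyE)
  have ab: "(a = u \<and> b = v) \<or> (a = v \<and> b = u)"
    using xs dec by (auto simp: successively_append_iff)
  have deg_ab: "card X < card (nbrs E X a) + card (nbrs E X b)" using ab deg by auto
  have succ: "successively (\<lambda>a b. (a, b) \<in> E) (as @ [a])" "successively (\<lambda>a b. (a, b) \<in> E) (b # bs)"
    by (rule successively_remove_pair[of u v];
        use xs dec ab in \<open>auto simp: successively_append_iff successively_Cons\<close>)+
  let ?C = "\<lambda>w w'. \<not> (w \<in> nbrs E X a \<and> w' \<in> nbrs E X b)"
  have "\<not> (successively ?C (as @ [a]) \<and> successively ?C (b # bs))"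
  proof
    assume *: "successively ?C (as @ [a]) \<and> successively ?C (b # bs)"
    have dist: "distinct (as @ [a])" "distinct (b # bs)" using xs dec by auto
    have ends: "last (as @ [a]) \<notin> nbrs E X a" "hd (b # bs) \<notin> nbrs E X b"
      using E by (auto simp: irrefl_def)
    have 1: "card (nbrs E X a \<inter> set (as @ [a])) + card (nbrs E X b \<inter> set (as @ [a])) \<le> length (as @ [a])"
      using card_Int_sum_le_length[OF dist(1) _ conjunct1[OF *]] ends(1) by (auto split: if_splits)
    have 2: "card (nbrs E X a \<inter> set (b # bs)) + card (nbrs E X b \<inter> set (b # bs)) \<le> length (b # bs)"
      using card_Int_sum_le_length[OF dist(2) _ conjunct2[OF *]] ends(2) by (auto split: if_splits)
    have split: "card (nbrs E X w) \<le> card (nbrs E X w \<inter> set (as @ [a])) + card (nbrs E X w \<inter> set (b # bs))" for w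
    proof -
      have "nbrs E X w = (nbrs E X w \<inter> set (as @ [a])) \<union> (nbrs E X w \<inter> set (b # bs))"
        using xs dec by auto
      then show ?thesis by (metis card_Un_le)
    qed
    moreover have "card X = length (as @ [a]) + length (b # bs)"
      using xs dec distinct_card[of xs] by auto
    ultimately show False using 1 2 deg_ab split[of a] split[of b] by linarith
  qed
  then consider "\<not> successively ?C (as @ [a])" | "\<not> successively ?C (b # bs)" by blast
  then show ?thesis
  proof cases
    case 1
    then obtain cs w w' ds where d: "as @ [a] = cs @ w # w' # ds" "(a, w) \<in> E" "(b, w') \<in> E"
      by (elim not_successivelyE) auto
    have xs': "xs = (cs @ w # w' # ds) @ b # bs" using dec(1) d(1) by simp
    have la: "last (w' # ds) = a" using d(1) by (metis last_appendR last_snoc list.distinct(1) last.simps)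
    \<comment> \<open>The pair lies before the gap: from \<open>w\<close> jump to \<open>a\<close>,
      go back to \<open>w'\<close>, and jump from there to \<open>b\<close>.\<close>
    have "ham_path E X p q ((cs @ [w]) @ rev (w' # ds) @ b # bs)"
    proof -
      have "successively (\<lambda>a b. (a, b) \<in> E) (cs @ [w])" "successively (\<lambda>a b. (a, b) \<in> E) (w' # ds)"
        using succ(1) unfolding d(1) by (simp_all add: successively_append_iff)
      moreover have "(w, a) \<in> E" using d E(1) by (auto dest: symD)
      moreover have "distinct ((cs @ [w]) @ rev (w' # ds) @ b # bs)"
        "set ((cs @ [w]) @ rev (w' # ds) @ b # bs) = X" "hd (cs @ [w]) = p" "last (b # bs) = q"
        using xs unfolding xs' by (auto simp: hd_append)
      ultimately show ?thesis
        using successively_reverse_segment[OF E(1), of "cs @ [w]" "w' # ds" "b # bs"]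
          succ(2) la symD[OF E(1) d(3)] unfolding ham_path_def
        by (simp add: hd_append split: if_splits)
    qed
    then show ?thesis by blast
  next
    case 2
    then obtain cs w w' ds where d: "b # bs = cs @ w # w' # ds" "(a, w) \<in> E" "(b, w') \<in> E"
      by (elim not_successivelyE) auto
    have xs': "xs = (as @ [a]) @ cs @ w # w' # ds" using dec(1) d(1) by simp
    have hb: "hd (cs @ [w]) = b" using d(1) by (cases cs) auto
    \<comment> \<open>The pair lies after the gap: from \<open>a\<close> jump to \<open>w\<close>,
      go back to \<open>b\<close>, and jump from there to \<open>w'\<close>.\<close>
    have "ham_path E X p q ((as @ [a]) @ rev (cs @ [w]) @ w' # ds)"
    proof -
      have "successively (\<lambda>a b. (a, b) \<in> E) (cs @ [w])" "successively (\<lambda>a b. (a, b) \<in> E) (w' # ds)"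
        using succ(2) unfolding d(1) by (simp_all add: successively_append_iff)
      moreover have "distinct ((as @ [a]) @ rev (cs @ [w]) @ w' # ds)"
        "set ((as @ [a]) @ rev (cs @ [w]) @ w' # ds) = X" "hd (as @ [a]) = p" "last (w' # ds) = q"
        using xs unfolding xs' by (auto simp: hd_append)
      moreover have "hd (cs @ w # w' # ds) = b" using d(1) by (metis list.sel(1))
      ultimately show ?thesis
        using successively_reverse_segment[OF E(1), of "as @ [a]" "cs @ [w]" "w' # ds"]
          succ(1) d(2,3) hb unfolding ham_path_def
        by (simp add: hd_append split: if_splits)
    qed
    then show ?thesis by blast
  qed
qed

section \<open>Hamiltonicity from degree conditions\<close>

text \<open>
  The set \<open>F\<close> of new edges is fixed beforehand, so degree sums need only be known in \<open>E\<close>.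
\<close>

lemma closure_stable:
  assumes step: "\<And>E' u v. sym E' \<Longrightarrow> irrefl E' \<Longrightarrow> E \<subseteq> E' \<Longrightarrow> (u, v) \<in> F \<Longrightarrow> (u, v) \<notin> E' \<Longrightarrow>
      H (insert (u, v) (insert (v, u) E')) \<Longrightarrow> H E'"
    and E: "sym E" "irrefl E" and F: "finite F" "irrefl F" and H: "H (E \<union> F \<union> F\<inverse>)"
  shows "H E"
proof -
  have "F' \<subseteq> F \<Longrightarrow> H (E \<union> F' \<union> F'\<inverse>) \<Longrightarrow> H E" if "finite F'" for F'
    using that
  proof (induction F' rule: finite_induct)
    case (insert e F')
    obtain u v where e: "e = (u, v)" by fastforce
    define E' where "E' = E \<union> F' \<union> F'\<inverse>"
    have E': "sym E'" "irrefl E'" "E \<subseteq> E'"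
      using E F insert.prems(1) by (auto simp: E'_def sym_def irrefl_def)
    have eq: "E \<union> insert e F' \<union> (insert e F')\<inverse> = insert (u, v) (insert (v, u) E')"
      by (auto simp: E'_def e)
    have "H E'"
    proof (cases "(u, v) \<in> E'")
      case True
      then have "insert (u, v) (insert (v, u) E') = E'" using E'(1) by (auto dest: symD)
      then show ?thesis using insert.prems(2) eq by metis
    next
      case False
      then show ?thesis using step[OF E', of u v] insert.prems eq e by auto
    qed
    then show ?case using insert E'_def by blast
  qed simp
  then show ?thesis using F(1) H by blast
qed

lemma card_nbrs_mono:
  assumes "finite X" "E \<subseteq> E'"
  shows "card (nbrs E X u) \<le> card (nbrs E' X u)"
  by (rule card_mono) (use assms in auto)

lemma ham_path_closure:
  assumes E: "sym E" "irrefl E" and X: "finite X" and F: "F \<subseteq> X \<times> X" "irrefl F"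
    and deg: "\<And>u v. (u, v) \<in> F \<Longrightarrow> card X < card (nbrs E X u) + card (nbrs E X v)"
    and path: "\<exists>xs. ham_path (E \<union> F \<union> F\<inverse>) X p q xs"
  shows "\<exists>xs. ham_path E X p q xs"
proof (rule closure_stable[where H = "\<lambda>E. \<exists>xs. ham_path E X p q xs" and F = F])
  fix E' u v
  assume E': "sym E'" "irrefl E'" "E \<subseteq> E'" and uv: "(u, v) \<in> F" "(u, v) \<notin> E'"
    and "\<exists>xs. ham_path (insert (u, v) (insert (v, u) E')) X p q xs"
  then obtain xs where xs: "ham_path (insert (u, v) (insert (v, u) E')) X p q xs" by blast
  have "u \<noteq> v" using F uv by (auto simp: irrefl_def)
  moreover have "card X < card (nbrs E' X u) + card (nbrs E' X v)"
    using deg[OF uv(1)] card_nbrs_mono[OF X E'(3), of u] card_nbrs_mono[OF X E'(3), of v] by linarith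
  ultimately show "\<exists>xs. ham_path E' X p q xs"
    using ham_path_closure_step[OF E'(1,2) _ uv(2) _ xs] by blast
qed (use assms finite_subset[OF F(1)] in auto)

lemma successively_distinct:
  assumes "distinct xs" "set xs \<subseteq> X" "\<And>u v. u \<in> X \<Longrightarrow> v \<in> X \<Longrightarrow> u \<noteq> v \<Longrightarrow> (u, v) \<in> E"
  shows "successively (\<lambda>u v. (u, v) \<in> E) xs"
  using assms(1,2)
proof (induction xs)
  case (Cons x xs)
  then show ?case by (cases xs) (auto intro!: assms(3))
qed simp

text \<open>Any two vertices have degree sum at least \<open>card X\<close>, so the closure may add
  all missing edges at once, and any ordering of \<open>X\<close> is a Hamiltonian cycle of the
  complete graph.\<close>

theorem dirac:
  assumes E: "sym E" "irrefl E" and X: "3 \<le> card X"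
    and deg: "\<And>u. u \<in> X \<Longrightarrow> card X \<le> 2 * card (nbrs E X u)"
  shows "\<exists>xs. ham_cycle E X xs"
proof (rule closure_stable[where H = "\<lambda>E. \<exists>xs. ham_cycle E X xs" and F = "X \<times> X - Id"])
  have fin: "finite X" using X by (metis card.infinite not_numeral_le_zero)
  fix E' u v
  assume E': "sym E'" "irrefl E'" "E \<subseteq> E'" and uv: "(u, v) \<in> X \<times> X - Id" "(u, v) \<notin> E'"
    and "\<exists>xs. ham_cycle (insert (u, v) (insert (v, u) E')) X xs"
  then obtain xs where xs: "ham_cycle (insert (u, v) (insert (v, u) E')) X xs" by blast
  have "card X \<le> card (nbrs E' X u) + card (nbrs E' X v)"
    using deg[of u] deg[of v] uv card_nbrs_mono[OF fin E'(3), of u] card_nbrs_mono[OF fin E'(3), of v]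
    by auto
  then show "\<exists>xs. ham_cycle E' X xs"
    using ham_cycle_closure_step[OF E'(1,2) _ uv(2) X _ xs] uv(1) by blast
next
  have fin: "finite X" using X by (metis card.infinite not_numeral_le_zero)
  then obtain xs where xs: "distinct xs" "set xs = X" using finite_distinct_list by blast
  then have "length xs \<ge> 3" using X distinct_card by metis
  then obtain a b c ys where "xs = a # b # c # ys"
    by (metis One_nat_def Suc_le_length_iff numeral_3_eq_3)
  then have "last xs \<noteq> hd xs" "hd xs \<in> X" "last xs \<in> X" "xs \<noteq> []" using xs by auto
  then have "ham_cycle (E \<union> (X \<times> X - Id) \<union> (X \<times> X - Id)\<inverse>) X xs"
    using xs successively_distinct[of xs X "E \<union> (X \<times> X - Id) \<union> (X \<times> X - Id)\<inverse>"]
    unfolding ham_cycle_def by blast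
  then show "\<exists>xs. ham_cycle (E \<union> (X \<times> X - Id) \<union> (X \<times> X - Id)\<inverse>) X xs" ..
  show "finite (X \<times> X - Id)" using fin by simp
qed (use assms in \<open>auto simp: irrefl_def\<close>)

text \<open>\<open>A\<close> is the core, one part of the sparse cut, and \<open>X - A\<close>
  consists of the cut vertices assigned to it. The constants serve two purposes: degree sums
  involving a core vertex exceed \<open>card X\<close>, and the slack survives the loss of two edges
  at each vertex with fewer than \<open>k\<close> further vertices deleted.\<close>

locale dense_side =
  fixes E :: "('a \<times> 'a) set" and X A :: "'a set" and k :: nat
  assumes sym_E: "sym E" and irrefl_E: "irrefl E" and fin: "finite X" and A_subset: "A \<subseteq> X"
    and deg_core: "p \<in> A \<Longrightarrow> card X \<le> card (nbrs E X p) + k + 2"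
    and deg_core_sum: "p \<in> A \<Longrightarrow> card X + k + 2 \<le> 2 * card (nbrs E X p)"
    and deg_rest: "q \<in> X - A \<Longrightarrow> k + 4 \<le> card (nbrs E A q)"
    and card_rest: "card (X - A) < card A" "card (X - A) < k"
begin

lemma card_X: "card X = card A + card (X - A)"
  using card_Diff_subset[of A X] card_mono[OF fin A_subset] finite_subset[OF A_subset fin] A_subset by simp

text \<open>The closure is taken in two rounds. The first joins every core vertex to all of
  \<open>X\<close>. Then each remaining vertex has degree at least \<open>card A\<close>, more than
  half of \<open>card X\<close>, so the second completes the graph. The proof undoes the rounds in
  reverse order.\<close>

lemma ham_connected:
  assumes "p \<in> X" "q \<in> X" "p \<noteq> q"
  shows "\<exists>xs. ham_path E X p q xs"
proof -
  define F where "F = {(a, x). a \<in> A \<and> x \<in> X \<and> a \<noteq> x}"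
  define E1 where "E1 = E \<union> F \<union> F\<inverse>"
  define F' where "F' = (X - A) \<times> (X - A) - Id"
  have E1: "sym E1" "irrefl E1"
    using sym_E irrefl_E by (auto simp: E1_def F_def sym_def irrefl_def)
  have "\<exists>xs. ham_path E1 X p q xs"
  proof (rule ham_path_closure[OF E1 fin, where F = F'])
    fix u v assume uv: "(u, v) \<in> F'"
    have "card A \<le> card (nbrs E1 X w)" if "w \<in> X - A" for w
      by (rule card_mono) (use fin A_subset that in \<open>auto simp: E1_def F_def\<close>)
    then have "card A \<le> card (nbrs E1 X u)" "card A \<le> card (nbrs E1 X v)"
      using uv by (auto simp: F'_def)
    then show "card X < card (nbrs E1 X u) + card (nbrs E1 X v)"
      using card_X card_rest by linarith
  next
    obtain ys where ys: "distinct ys" "set ys = X - {p, q}" using finite_distinct_list fin by blast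
    have complete: "(u, v) \<in> E1 \<union> F' \<union> F'\<inverse>" if "u \<in> X" "v \<in> X" "u \<noteq> v" for u v
      using that by (auto simp: E1_def F_def F'_def)
    have "successively (\<lambda>u v. (u, v) \<in> E1 \<union> F' \<union> F'\<inverse>) (p # ys @ [q])"
      by (rule successively_distinct[of _ X]) (use ys assms complete in auto)
    then have "ham_path (E1 \<union> F' \<union> F'\<inverse>) X p q (p # ys @ [q])"
      using ys assms by (auto simp: ham_path_def)
    then show "\<exists>xs. ham_path (E1 \<union> F' \<union> F'\<inverse>) X p q xs" ..
  qed (auto simp: F'_def irrefl_def)
  then show ?thesis
    unfolding E1_def
  proof (rule ham_path_closure[OF sym_E irrefl_E fin, where F = F, rotated -1])
    fix u v assume uv: "(u, v) \<in> F"
    show "card X < card (nbrs E X u) + card (nbrs E X v)"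
    proof (cases "v \<in> A")
      case True
      then show ?thesis using deg_core_sum[of u] deg_core_sum[of v] uv by (auto simp: F_def)
    next
      case False
      have "card (nbrs E A v) \<le> card (nbrs E X v)"
        by (rule card_mono) (use fin A_subset in auto)
      then show ?thesis using False deg_core[of u] deg_rest[of v] uv by (auto simp: F_def)
    qed
  qed (use A_subset in \<open>auto simp: F_def irrefl_def\<close>)
qed

text \<open>A dense side stays \<open>k\<close>-connected after losing two edges per vertex. Core
  vertices on opposite sides of a separation would share too few neighbours. If one of
  \<open>P\<close>, \<open>Q\<close> contains no core vertex, its vertices have all their remaining
  core neighbours in the cut, which is too small.\<close>

lemma edge_between_parts:
  assumes E': "sym E'" "E' \<subseteq> E" and loss: "\<And>u. card (nbrs E X u - nbrs E' X u) \<le> 2"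
    and PQ: "P \<noteq> {}" "Q \<noteq> {}" "P \<inter> Q = {}" "P \<union> Q \<subseteq> X" "card (X - (P \<union> Q)) < k"
  shows "\<exists>u\<in>P. \<exists>v\<in>Q. (u, v) \<in> E'"
proof (rule ccontr)
  assume no: "\<not> ?thesis"
  then have no': "(u, v) \<notin> E'" "(v, u) \<notin> E'" if "u \<in> P" "v \<in> Q" for u v
    using that E'(1) by (auto dest: symD)
  have loss': "card (nbrs E Y u) \<le> card (nbrs E' Y u) + 2" if "Y \<subseteq> X" for Y u
  proof -
    have fY: "finite Y" using that fin finite_subset by blast
    have "nbrs E Y u = nbrs E' Y u \<union> (nbrs E Y u - nbrs E' Y u)" using E'(2) by auto
    then have "card (nbrs E Y u) \<le> card (nbrs E' Y u) + card (nbrs E Y u - nbrs E' Y u)"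
      by (metis card_Un_le)
    moreover have "card (nbrs E Y u - nbrs E' Y u) \<le> card (nbrs E X u - nbrs E' X u)"
      by (rule card_mono) (use fin that in auto)
    ultimately show ?thesis using loss[of u] by linarith
  qed
  let ?T = "X - (P \<union> Q)"
  have "A \<inter> P = {} \<or> A \<inter> Q = {}"
  proof (rule ccontr)
    assume "\<not> ?thesis"
    then obtain p q where p: "p \<in> A" "p \<in> P" and q: "q \<in> A" "q \<in> Q" by blast
    let ?N = "nbrs E' X p" and ?M = "nbrs E' X q"
    have "p \<noteq> q" using p q PQ by blast
    have nn: "(p, p) \<notin> E'" "(q, q) \<notin> E'" using irrefl_E E'(2) by (auto simp: irrefl_def)
    have "card ?N + card ?M = card (?N \<union> ?M) + card (?N \<inter> ?M)"
      using fin by (intro card_Un_Int) auto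
    also have "card (?N \<inter> ?M) \<le> card ?T"
      by (rule card_mono) (use fin no' p q in auto)
    also have "card (?N \<union> ?M) \<le> card (X - {p, q})"
      by (rule card_mono) (use fin no' p q nn in auto)
    also have "card (X - {p, q}) = card X - 2"
      using p q A_subset \<open>p \<noteq> q\<close> by (subst card_Diff_subset) auto
    finally have "card ?N + card ?M \<le> card X - 2 + card ?T" by simp
    moreover have "card X \<ge> 2"
      using card_mono[OF fin, of "{p, q}"] p(1) q(1) A_subset \<open>p \<noteq> q\<close> by (auto simp: subset_iff)
    \<comment> \<open>This is tight: the degrees in \<open>E'\<close> add up to at least
      \<open>card X + k - 2\<close>, while the bound gives at most
      \<open>card X + k - 3\<close>.\<close>
    ultimately show False
      using PQ(5) deg_core_sum[OF p(1)] deg_core_sum[OF q(1)] loss'[OF subset_refl, of p]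
        loss'[OF subset_refl, of q] by linarith
  qed
  moreover have False if "u \<in> X - A" "nbrs E' A u \<subseteq> ?T" for u
  proof -
    have "card (nbrs E' A u) \<le> card ?T"
      using that(2) fin by (intro card_mono) auto
    then show False
      using deg_rest[OF that(1)] loss'[OF A_subset, of u] PQ(5) by linarith
  qed
  moreover obtain p q where "p \<in> P" "q \<in> Q" using PQ(1,2) by blast
  moreover have "nbrs E' A p \<subseteq> ?T" if "A \<inter> P = {}"
    using that A_subset no'(1)[OF \<open>p \<in> P\<close>] by auto
  moreover have "nbrs E' A q \<subseteq> ?T" if "A \<inter> Q = {}"
    using that A_subset no'(2)[OF _ \<open>q \<in> Q\<close>] by auto
  ultimately show False using PQ(4) by blast
qed

end

section \<open>Matchings between two sides\<close>

text \<open>Finiteness is included because \<open>card\<close> of an infinite set is 0, which would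
  spoil lower bounds on the size of covers.\<close>

definition vertex_cover :: "('a \<times> 'a) set \<Rightarrow> 'a set \<Rightarrow> bool" where
  "vertex_cover D C \<longleftrightarrow> finite C \<and> (\<forall>(u, v)\<in>D. u \<in> C \<or> v \<in> C)"

lemma card_Int_parts_le:
  assumes "finite C" "X \<inter> Y = {}"
  shows "card (C \<inter> X) + card (C \<inter> Y) \<le> card C"
proof -
  have "card (C \<inter> X) + card (C \<inter> Y) = card (C \<inter> X \<union> C \<inter> Y)"
    by (rule card_Un_disjoint[symmetric]) (use assms in auto)
  also have "\<dots> \<le> card C" by (rule card_mono) (use assms in auto)
  finally show ?thesis .
qed

text \<open>
  If two edges \<open>xy1\<close>, \<open>xy2\<close> share \<open>x\<close>, uncrossing small covers \<open>C1\<close>, \<open>C2\<close> of the graphs without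
  \<open>xy1\<close> and without \<open>xy2\<close> gives sets \<open>D1\<close>, \<open>D2\<close> with at most \<open>2k - 2\<close> elements in total such that
  \<open>D1\<close> and \<open>insert x D2\<close> are covers.
\<close>

lemma critical_imp_inj_on_fst:
  assumes D: "D \<subseteq> X \<times> Y" "X \<inter> Y = {}"
    and cov: "\<And>C. vertex_cover D C \<Longrightarrow> k \<le> card C"
    and crit: "\<And>e. e \<in> D \<Longrightarrow> \<exists>C. vertex_cover (D - {e}) C \<and> card C < k"
  shows "inj_on fst D"
proof (rule inj_onI, rule ccontr)
  fix e f assume ef: "e \<in> D" "f \<in> D" "fst e = fst f" "e \<noteq> f"
  obtain x y1 y2 where xy: "e = (x, y1)" "f = (x, y2)" "y1 \<noteq> y2"
    using ef by (metis prod.collapse)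
  obtain C1 where C1: "vertex_cover (D - {e}) C1" "card C1 < k" using crit ef(1) by blast
  obtain C2 where C2: "vertex_cover (D - {f}) C2" "card C2 < k" using crit ef(2) by blast
  have fin: "finite C1" "finite C2" using C1 C2 by (auto simp: vertex_cover_def)
  have "\<not> vertex_cover D C1" "\<not> vertex_cover D C2" using cov C1 C2 by (auto simp: not_le[symmetric])
  \<comment> \<open>A small cover of all edges but \<open>e\<close> must miss both ends of
    \<open>e\<close>. As it still covers \<open>f\<close> but not through \<open>x\<close>, it
    contains \<open>y2\<close>; the roles of \<open>e\<close> and \<open>f\<close> are then
    exchanged.\<close>
  then have "x \<notin> C1" "y1 \<notin> C1" "x \<notin> C2" "y2 \<notin> C2"
    using C1 C2 xy unfolding vertex_cover_def by fast+
  moreover from this have "y2 \<in> C1" "y1 \<in> C2"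
    using C1 C2 xy ef unfolding vertex_cover_def by fast+
  ultimately have mem: "x \<notin> C1" "x \<notin> C2" "y2 \<in> C1" "y1 \<in> C2" by auto
  define D1 where "D1 = C1 \<inter> C2 \<inter> X \<union> (C1 \<union> C2) \<inter> Y"
  define D2 where "D2 = (C1 \<union> C2) \<inter> X \<union> C1 \<inter> C2 \<inter> Y"
  have cov1: "u \<in> C1 \<or> v \<in> C1" if "(u, v) \<in> D" "(u, v) \<noteq> e" for u v
    using C1 that unfolding vertex_cover_def by fast
  have cov2: "u \<in> C2 \<or> v \<in> C2" if "(u, v) \<in> D" "(u, v) \<noteq> f" for u v
    using C2 that unfolding vertex_cover_def by fast
  have "vertex_cover D D1" unfolding vertex_cover_def
  proof (intro conjI ballI, goal_cases)
    case (2 g)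
    obtain u v where g: "g = (u, v)" by fastforce
    then have uv: "u \<in> X" "v \<in> Y" "(u, v) \<in> D" using 2 D by auto
    then show ?case using cov1[of u v] cov2[of u v] mem xy g unfolding D1_def by blast
  qed (use fin in \<open>auto simp: D1_def\<close>)
  then have "k \<le> card D1" by (rule cov)
  have "vertex_cover D (insert x D2)" unfolding vertex_cover_def
  proof (intro conjI ballI, goal_cases)
    case (2 g)
    obtain u v where g: "g = (u, v)" by fastforce
    then have uv: "u \<in> X" "v \<in> Y" "(u, v) \<in> D" using 2 D by auto
    then show ?case using cov1[of u v] cov2[of u v] mem xy g unfolding D2_def by blast
  qed (use fin in \<open>auto simp: D2_def\<close>)
  then have "k \<le> card (insert x D2)" by (rule cov)
  moreover have "finite D2" using fin by (simp add: D2_def)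
  ultimately have "k \<le> card D2 + 1" by (auto simp: card_insert_if split: if_splits)
  have "card D1 = card (C1 \<inter> C2 \<inter> X) + card ((C1 \<union> C2) \<inter> Y)"
    unfolding D1_def by (rule card_Un_disjoint) (use fin D in auto)
  moreover have "card D2 = card ((C1 \<union> C2) \<inter> X) + card (C1 \<inter> C2 \<inter> Y)"
    unfolding D2_def by (rule card_Un_disjoint) (use fin D in auto)
  moreover have split: "card (C1 \<inter> Z) + card (C2 \<inter> Z) = card ((C1 \<union> C2) \<inter> Z) + card (C1 \<inter> C2 \<inter> Z)" for Z
  proof -
    have "C1 \<inter> Z \<union> C2 \<inter> Z = (C1 \<union> C2) \<inter> Z" "C1 \<inter> Z \<inter> (C2 \<inter> Z) = C1 \<inter> C2 \<inter> Z" by blast+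
    then show ?thesis using card_Un_Int[of "C1 \<inter> Z" "C2 \<inter> Z"] fin by simp
  qed
  ultimately have "card D1 + card D2 \<le> card C1 + card C2"
    using split[of X] split[of Y] card_Int_parts_le[OF fin(1) D(2)]
      card_Int_parts_le[OF fin(2) D(2)] by linarith
  \<comment> \<open>The total is at most \<open>2 * k - 2\<close>, but the two covers force at least
    \<open>k + (k - 1)\<close>.\<close>
  then show False using \<open>k \<le> card D1\<close> \<open>k \<le> card D2 + 1\<close> C1(2) C2(2) by linarith
qed

lemma vertex_cover_converse: "vertex_cover (D\<inverse>) C \<longleftrightarrow> vertex_cover D C"
  by (auto simp: vertex_cover_def)

text \<open>Edges are deleted as long as every cover still has at least \<open>k\<close> elements.
  Once no edge can be deleted, criticality on both sides makes \<open>D\<close> itself a matching.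
  Its left ends form a cover, so it has at least \<open>k\<close> edges.\<close>

theorem koenig:
  assumes "finite D" "D \<subseteq> X \<times> Y" "X \<inter> Y = {}"
    and "\<And>C. vertex_cover D C \<Longrightarrow> k \<le> card C"
  shows "\<exists>M \<subseteq> D. card M = k \<and> inj_on fst M \<and> inj_on snd M"
  using assms
proof (induction D rule: finite_psubset_induct)
  case (psubset D)
  show ?case
  proof (cases "\<exists>e\<in>D. \<forall>C. vertex_cover (D - {e}) C \<longrightarrow> k \<le> card C")
    case True
    then obtain e where e: "e \<in> D" "\<And>C. vertex_cover (D - {e}) C \<Longrightarrow> k \<le> card C" by blast
    then have "\<exists>M \<subseteq> D - {e}. card M = k \<and> inj_on fst M \<and> inj_on snd M"
      using psubset.prems by (intro psubset.IH) auto
    then show ?thesis by blast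
  next
    case False
    then have crit: "\<exists>C. vertex_cover (D - {e}) C \<and> card C < k" if "e \<in> D" for e
      using that by (meson not_le)
    have 1: "inj_on fst D"
      by (rule critical_imp_inj_on_fst[OF psubset.prems(1,2,3) crit])
    have "inj_on fst (D\<inverse>)"
    proof (rule critical_imp_inj_on_fst)
      show "D\<inverse> \<subseteq> Y \<times> X" "Y \<inter> X = {}" using psubset.prems by auto
      show "k \<le> card C" if "vertex_cover (D\<inverse>) C" for C
        using that psubset.prems(3) vertex_cover_converse by blast
      show "\<exists>C. vertex_cover (D\<inverse> - {e}) C \<and> card C < k" if "e \<in> D\<inverse>" for e
      proof -
        have "D\<inverse> - {e} = (D - {prod.swap e})\<inverse>" by (cases e) auto
        then show ?thesis
          using crit[of "prod.swap e"] that vertex_cover_converse by (cases e) auto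
      qed
    qed
    then have 2: "inj_on snd D"
      by (fastforce intro!: inj_onI dest: inj_onD[where x = "(_, _)" and y = "(_, _)"])
    have "vertex_cover D (fst ` D)" using psubset.hyps(1) by (force simp: vertex_cover_def)
    then have "k \<le> card D" using psubset.prems(3) card_image[OF 1] by fastforce
    then obtain M where M: "M \<subseteq> D" "card M = k" by (rule obtain_subset_with_card_n)
    then show ?thesis using inj_on_subset[OF 1 M(1)] inj_on_subset[OF 2 M(1)] by blast
  qed
qed

text \<open>Each edge is charged to an end in \<open>C\<close>, and no vertex is charged twice. This
  is how a surviving matching of \<open>k\<close> edges rules out smaller cuts.\<close>

lemma matching_le_vertex_cover:
  assumes M: "M \<subseteq> X \<times> Y" "X \<inter> Y = {}" "inj_on fst M" "inj_on snd M" and C: "vertex_cover M C"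
  shows "card M \<le> card C"
proof -
  have finC: "finite C" using C by (simp add: vertex_cover_def)
  let ?M1 = "{e \<in> M. fst e \<in> C}" and ?M2 = "{e \<in> M. snd e \<in> C}"
  have "M = ?M1 \<union> ?M2" using C by (auto simp: vertex_cover_def)
  then have "card M = card (?M1 \<union> ?M2)" by (rule arg_cong)
  also have "\<dots> \<le> card ?M1 + card ?M2" by (rule card_Un_le)
  also have "card ?M1 \<le> card (C \<inter> X)"
    by (rule card_inj_on_le[of fst]) (use M finC inj_on_subset[OF M(3), of ?M1] in auto)
  also have "card ?M2 \<le> card (C \<inter> Y)"
    by (rule card_inj_on_le[of snd]) (use M finC inj_on_subset[OF M(4), of ?M2] in auto)
  also have "card (C \<inter> X) + card (C \<inter> Y) \<le> card C"
    using card_Int_parts_le finC M(2) by blast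
  finally show ?thesis by simp
qed

lemma two_outside:
  assumes "finite X" "finite M" "inj_on f M" "card M + 2 \<le> card X"
  obtains x1 x2 where "x1 \<in> X - f ` M" "x2 \<in> X - f ` M" "x1 \<noteq> x2"
proof -
  have "2 \<le> card (X - f ` M)"
    using diff_card_le_card_Diff[of "f ` M" X] card_image[OF assms(3)] assms by simp
  then obtain B where "B \<subseteq> X - f ` M" "card B = 2" by (rule obtain_subset_with_card_n)
  then show ?thesis using that by (auto simp: card_2_iff)
qed

text \<open>Edges at vertices of \<open>X\<close> unmatched by \<open>M\<close> avoid
  \<open>M\<close> automatically; the second neighbour keeps the two edges disjoint. This serves the
  case of unequal sides.\<close>

lemma two_disjoint_edges_left:
  assumes X: "finite X" "card M + 2 \<le> card X" "finite M" and M: "inj_on fst M"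
    and deg: "\<And>x. x \<in> X \<Longrightarrow> 2 \<le> card (nbrs E Y x)"
  obtains x1 y1 x2 y2 where "x1 \<in> X" "x2 \<in> X" "y1 \<in> Y" "y2 \<in> Y" "x1 \<noteq> x2" "y1 \<noteq> y2"
    "(x1, y1) \<in> E - M" "(x2, y2) \<in> E - M"
proof -
  obtain x1 x2 where x: "x1 \<in> X - fst ` M" "x2 \<in> X - fst ` M" "x1 \<noteq> x2"
    using two_outside[OF X(1,3) M X(2)] by blast
  have "nbrs E Y x1 \<noteq> {}" using deg[of x1] x by force
  then obtain y1 where y1: "y1 \<in> nbrs E Y x1" by blast
  have "\<not> nbrs E Y x2 \<subseteq> {y1}" using deg[of x2] x card_mono[of "{y1}" "nbrs E Y x2"] by force
  then obtain y2 where "y2 \<in> nbrs E Y x2" "y2 \<noteq> y1" by blast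
  then show ?thesis using that[of x1 x2 y1 y2] x y1 by force
qed

lemma two_disjoint_edges_both:
  assumes X: "finite X" "card M + 2 \<le> card X" and Y: "finite Y" "card M + 2 \<le> card Y"
    and M: "finite M" "inj_on fst M" "inj_on snd M" and E: "sym E"
    and deg: "\<And>x. x \<in> X \<Longrightarrow> nbrs E Y x \<noteq> {}" "\<And>y. y \<in> Y \<Longrightarrow> nbrs E X y \<noteq> {}"
  obtains x1 y1 x2 y2 where "x1 \<in> X" "x2 \<in> X" "y1 \<in> Y" "y2 \<in> Y" "x1 \<noteq> x2" "y1 \<noteq> y2"
    "(x1, y1) \<in> E - M" "(x2, y2) \<in> E - M"
proof -
  obtain x1 x2 where x: "x1 \<in> X - fst ` M" "x2 \<in> X - fst ` M" "x1 \<noteq> x2"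
    using two_outside[OF X(1) M(1,2) X(2)] by blast
  obtain y1 y2 where y: "y1 \<in> Y - snd ` M" "y2 \<in> Y - snd ` M" "y1 \<noteq> y2"
    using two_outside[OF Y(1) M(1,3) Y(2)] by blast
  obtain z1 z2 where z: "z1 \<in> nbrs E Y x1" "z2 \<in> nbrs E Y x2" using deg(1) x by blast
  show ?thesis
  proof (cases "z1 = z2")
    case False
    then show ?thesis using that[of x1 x2 z1 z2] x z by force
  next
    case True
    \<comment> \<open>Both edges end in \<open>z1\<close>. One of them is replaced by an edge at
      another unmatched \<open>y\<close>, and the one that is kept starts away from its end
      \<open>w\<close>.\<close>
    obtain y where yy: "y \<in> Y - snd ` M" "y \<noteq> z1" using y by metis
    then obtain w where w: "w \<in> nbrs E X y" using deg(2) by blast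
    obtain x where xx: "x \<in> X - fst ` M" "x \<noteq> w" "z1 \<in> nbrs E Y x" using x z True by metis
    have "(w, y) \<in> E - M" using w yy E by (force dest: symD)
    moreover have "(x, z1) \<in> E - M" using xx by force
    ultimately show ?thesis using that[of x w z1 y] xx yy w by auto
  qed
qed

section \<open>Cycles that cross a sparse cut twice\<close>

definition remove_cycle :: "('a \<times> 'a) set \<Rightarrow> 'a list \<Rightarrow> ('a \<times> 'a) set" where
  "remove_cycle E xs = E - (set (cycle_arcs xs) \<union> (set (cycle_arcs xs))\<inverse>)"

lemma sym_remove_cycle: "sym E \<Longrightarrow> sym (remove_cycle E xs)"
  by (auto simp: remove_cycle_def sym_def)

lemma remove_cycle_subset: "remove_cycle E xs \<subseteq> E"
  by (auto simp: remove_cycle_def)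

lemma card_nbrs_remove_cycle:
  assumes "distinct xs"
  shows "card (nbrs E W u - nbrs (remove_cycle E xs) W u) \<le> 2"
proof -
  let ?N = "{v. (u, v) \<in> set (cycle_arcs xs) \<union> (set (cycle_arcs xs))\<inverse>}"
  have "?N \<subseteq> snd ` set (cycle_arcs xs) \<union> fst ` set (cycle_arcs xs)" by force
  then have "finite ?N" by (rule finite_subset) simp
  then have "card (nbrs E W u - nbrs (remove_cycle E xs) W u) \<le> card ?N"
    by (rule card_mono) (auto simp: remove_cycle_def)
  then show ?thesis using card_cycle_arcs_nbrs[OF assms, of u] by linarith
qed

text \<open>The second claim is what protects the matching: apart from the two linking edges, every
  arc stays within one side.\<close>

lemma cycle_of_two_paths:
  assumes ps: "ham_path E X x2 x1 ps" and qs: "ham_path E Y y1 y2 qs" and XY: "X \<inter> Y = {}"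
    and e: "(x1, y1) \<in> E" "(y2, x2) \<in> E"
  shows "ham_cycle E (X \<union> Y) (ps @ qs)"
    and "set (cycle_arcs (ps @ qs)) \<subseteq> X \<times> X \<union> Y \<times> Y \<union> {(x1, y1), (y2, x2)}"
proof -
  note P = ps[unfolded ham_path_def] and Q = qs[unfolded ham_path_def]
  show "ham_cycle E (X \<union> Y) (ps @ qs)"
    unfolding ham_cycle_def
  proof (intro conjI)
    show "successively (\<lambda>u v. (u, v) \<in> E) (ps @ qs)"
      unfolding successively_append_iff using P Q e by simp
  qed (use P Q XY e in auto)
  have "rotate1 (ps @ qs) = (tl ps @ [hd qs]) @ (tl qs @ [hd ps])"
    using P Q by (cases ps; cases qs) simp_all
  then have "cycle_arcs (ps @ qs) = zip ps (tl ps @ [hd qs]) @ zip qs (tl qs @ [hd ps])"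
    using P zip_append[of ps "tl ps @ [hd qs]" qs "tl qs @ [hd ps]"] by (simp add: cycle_arcs_def)
  moreover have "set (zip ps (tl ps @ [hd qs])) \<subseteq> X \<times> X \<union> {(x1, y1)}"
  proof (rule arcs_along_list)
    show "successively (\<lambda>u v. (u, v) \<in> X \<times> X \<union> {(x1, y1)}) ps"
      by (rule successively_distinct[of _ X]) (use P in auto)
  qed (use P Q in auto)
  moreover have "set (zip qs (tl qs @ [hd ps])) \<subseteq> Y \<times> Y \<union> {(y2, x2)}"
  proof (rule arcs_along_list)
    show "successively (\<lambda>u v. (u, v) \<in> Y \<times> Y \<union> {(y2, x2)}) qs"
      by (rule successively_distinct[of _ Y]) (use Q in auto)
  qed (use P Q in auto)
  ultimately show "set (cycle_arcs (ps @ qs)) \<subseteq> X \<times> X \<union> Y \<times> Y \<union> {(x1, y1), (y2, x2)}"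
    by auto
qed

lemma card_nbrs_Un:
  assumes "finite X" "finite Y"
  shows "card (nbrs E (X \<union> Y) u) \<le> card (nbrs E X u) + card (nbrs E Y u)"
proof -
  have "nbrs E (X \<union> Y) u = nbrs E X u \<union> nbrs E Y u" by auto
  then show ?thesis by (metis card_Un_le)
qed

lemma card_nbrs_less:
  assumes "finite X" "irrefl E" "u \<in> X"
  shows "card (nbrs E X u) < card X"
proof (rule psubset_card_mono[OF assms(1)])
  have "u \<notin> nbrs E X u" using assms(2) by (simp add: irrefl_def)
  then show "nbrs E X u \<subset> X" using assms(3) by (auto simp: nbrs_def)
qed

text \<open>Each side stays \<open>k\<close>-connected without the cycle, so a separation of order
  below \<open>k\<close> would have to place \<open>P\<close> and \<open>Q\<close> in different
  sides, where the surviving matching still joins them. The bound \<open>k + 2\<close> leaves two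
  unmatched vertices in each side.\<close>

lemma two_dense_sides:
  assumes X: "dense_side E X A k" and Y: "dense_side E Y B k" and XY: "X \<inter> Y = {}"
    and size: "card X \<le> card Y" "k + 2 \<le> card X"
    and cut: "no_small_cut k (X \<union> Y) E"
    and deg: "\<And>u. u \<in> X \<union> Y \<Longrightarrow> card (X \<union> Y) \<le> 2 * card (nbrs E (X \<union> Y) u)"
  shows "\<exists>xs. ham_cycle E (X \<union> Y) xs \<and> no_small_cut k (X \<union> Y) (remove_cycle E xs)"
proof -
  interpret X: dense_side E X A k by fact
  interpret Y: dense_side E Y B k by fact
  note sym = X.sym_E
  define D where "D = E \<inter> X \<times> Y"
  have finD: "finite D" using X.fin Y.fin by (auto simp: D_def)
  \<comment> \<open>A cover of the crossing edges with fewer than \<open>k\<close> vertices would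
    separate \<open>X - C\<close> from \<open>Y - C\<close> in the original graph.\<close>
  have "k \<le> card C" if C: "vertex_cover D C" for C
  proof (rule ccontr)
    assume "\<not> ?thesis"
    then have small: "card C < k" by simp
    have finC: "finite C" using C by (simp add: vertex_cover_def)
    have ne: "Z - C \<noteq> {}" if "k + 2 \<le> card Z" for Z
      using that small finC card_mono[of C Z] by auto
    have "card (X \<union> Y - ((X - C) \<union> (Y - C))) \<le> card C"
      by (rule card_mono) (use finC in auto)
    then have "card (X \<union> Y - ((X - C) \<union> (Y - C))) < k" using small by linarith
    moreover have "X - C \<noteq> {}" "Y - C \<noteq> {}" using ne size by simp_all
    moreover have "(X - C) \<inter> (Y - C) = {}" "(X - C) \<union> (Y - C) \<subseteq> X \<union> Y" using XY by blast+
    ultimately have "\<exists>u\<in>X - C. \<exists>v\<in>Y - C. (u, v) \<in> E"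
      by (intro cut[unfolded no_small_cut_def, rule_format])
    then show False using C by (auto simp: vertex_cover_def D_def)
  qed
  then obtain M where M: "M \<subseteq> D" "card M = k" "inj_on fst M" "inj_on snd M"
    using koenig[OF finD _ XY, of k] unfolding D_def by blast
  have finM: "finite M" using M(1) finD finite_subset by blast
  have cardXY: "card (X \<union> Y) = card X + card Y"
    using X.fin Y.fin XY by (rule card_Un_disjoint)
  \<comment> \<open>A vertex has at most \<open>card X - 1\<close> neighbours in its own side, so
    the degree condition forces crossing edges: at least one if the sides are equal, at least two
    from the strictly smaller side.\<close>
  have cross_X: "card X + card Y + 2 \<le> 2 * card X + 2 * card (nbrs E Y x)" if "x \<in> X" for x
    using deg[of x] card_nbrs_less[OF X.fin X.irrefl_E that] card_nbrs_Un[OF X.fin Y.fin, of E x]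
      that cardXY by auto
  have cross_Y: "card X + card Y + 2 \<le> 2 * card Y + 2 * card (nbrs E X y)" if "y \<in> Y" for y
    using deg[of y] card_nbrs_less[OF Y.fin X.irrefl_E that] card_nbrs_Un[OF X.fin Y.fin, of E y]
      that cardXY by auto
  obtain x1 y1 x2 y2 where e: "x1 \<in> X" "x2 \<in> X" "y1 \<in> Y" "y2 \<in> Y" "x1 \<noteq> x2" "y1 \<noteq> y2"
    "(x1, y1) \<in> E - M" "(x2, y2) \<in> E - M"
  proof (cases "card X = card Y")
    case True
    have X_edges: "nbrs E Y x \<noteq> {}" if "x \<in> X" for x using cross_X[OF that] True by auto
    have Y_edges: "nbrs E X y \<noteq> {}" if "y \<in> Y" for y using cross_Y[OF that] True by auto
    have "card M + 2 \<le> card X" "card M + 2 \<le> card Y" using M(2) size by auto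
    then show ?thesis
      by (rule two_disjoint_edges_both[OF X.fin _ Y.fin _ finM M(3,4) sym X_edges Y_edges]) (assumption+, rule that)
  next
    case False
    have X_edges: "2 \<le> card (nbrs E Y x)" if "x \<in> X" for x
      using cross_X[OF that] False size(1) by linarith
    have "card M + 2 \<le> card X" using M(2) size by auto
    then show ?thesis
      by (rule two_disjoint_edges_left[OF X.fin _ finM M(3) X_edges]) (assumption, rule that)
  qed
  obtain ps where ps: "ham_path E X x2 x1 ps" using X.ham_connected e by metis
  obtain qs where qs: "ham_path E Y y1 y2 qs" using Y.ham_connected e by metis
  have arcs: "(x1, y1) \<in> E" "(y2, x2) \<in> E" using e sym by (auto dest: symD)
  define H where "H = ps @ qs"
  have H: "ham_cycle E (X \<union> Y) H"
    and H_arcs: "set (cycle_arcs H) \<subseteq> X \<times> X \<union> Y \<times> Y \<union> {(x1, y1), (y2, x2)}"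
    using cycle_of_two_paths[OF ps qs XY arcs] by (simp_all add: H_def)
  define E' where "E' = remove_cycle E H"
  have E': "sym E'" "E' \<subseteq> E" unfolding E'_def
    by (rule sym_remove_cycle[OF sym], rule remove_cycle_subset)
  have loss: "card (nbrs E W u - nbrs E' W u) \<le> 2" for W u
    unfolding E'_def by (rule card_nbrs_remove_cycle) (use H in \<open>simp add: ham_cycle_def\<close>)
  have "M \<subseteq> E'"
  proof
    fix m assume m: "m \<in> M"
    then obtain u v where uv: "m = (u, v)" "(u, v) \<in> E" "u \<in> X" "v \<in> Y" "u \<notin> Y" "v \<notin> X"
      using M(1) XY by (cases m) (auto simp: D_def)
    then have "(u, v) \<noteq> (x1, y1)" "(u, v) \<noteq> (x2, y2)" using m e by auto
    then have "(u, v) \<notin> set (cycle_arcs H)" "(v, u) \<notin> set (cycle_arcs H)"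
      using H_arcs uv e by blast+
    then show "m \<in> E'" using uv by (simp add: E'_def remove_cycle_def)
  qed
  have cross: "\<exists>u\<in>P. \<exists>v\<in>Q. (u, v) \<in> E'"
    if "P \<subseteq> X" "Q \<subseteq> Y" "card (X \<union> Y - (P \<union> Q)) < k" for P Q
  proof (rule ccontr)
    assume no: "\<not> ?thesis"
    have "M \<subseteq> X \<times> Y" using M(1) by (auto simp: D_def)
    \<comment> \<open>With no edge left between \<open>P\<close> and \<open>Q\<close>, every edge of
      \<open>M\<close> has an end among the fewer than \<open>k\<close> deleted vertices.\<close>
    moreover have "vertex_cover M (X \<union> Y - (P \<union> Q))"
      unfolding vertex_cover_def
    proof (intro conjI ballI)
      fix m assume "m \<in> M"
      then obtain u v where "m = (u, v)" "u \<in> X" "v \<in> Y" "(u, v) \<in> E'"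
        using \<open>M \<subseteq> E'\<close> \<open>M \<subseteq> X \<times> Y\<close> by (cases m) auto
      moreover from this have "u \<notin> Q" "v \<notin> P" "u \<notin> P \<or> v \<notin> Q"
        using that(1,2) XY no by blast+
      ultimately show "case m of (u, v) \<Rightarrow> u \<in> X \<union> Y - (P \<union> Q) \<or> v \<in> X \<union> Y - (P \<union> Q)"
        by simp
    qed (use X.fin Y.fin in simp)
    ultimately show False
      using matching_le_vertex_cover[OF _ XY M(3,4)] M(2) that(3) by fastforce
  qed
  have "no_small_cut k (X \<union> Y) E'"
    unfolding no_small_cut_def
  proof (intro allI impI)
    fix P Q assume PQ: "P \<noteq> {}" "Q \<noteq> {}" "P \<inter> Q = {}" "P \<union> Q \<subseteq> X \<union> Y"
      "card (X \<union> Y - (P \<union> Q)) < k"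
    have inside: "card (Z - (P \<inter> Z \<union> Q \<inter> Z)) < k" if "Z \<subseteq> X \<union> Y" for Z
    proof -
      have "card (Z - (P \<inter> Z \<union> Q \<inter> Z)) \<le> card (X \<union> Y - (P \<union> Q))"
        by (rule card_mono) (use X.fin Y.fin that in auto)
      then show ?thesis using PQ(5) by linarith
    qed
    show "\<exists>u\<in>P. \<exists>v\<in>Q. (u, v) \<in> E'"
    proof (rule ccontr)
      assume no: "\<not> ?thesis"
      have "P \<inter> X = {} \<or> Q \<inter> X = {}"
      proof (rule ccontr)
        assume "\<not> ?thesis"
        then have "\<exists>u\<in>P \<inter> X. \<exists>v\<in>Q \<inter> X. (u, v) \<in> E'"
          using inside[of X] PQ(3) by (intro X.edge_between_parts[OF E' loss]) auto
        then show False using no by blast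
      qed
      moreover have "P \<inter> Y = {} \<or> Q \<inter> Y = {}"
      proof (rule ccontr)
        assume "\<not> ?thesis"
        then have "\<exists>u\<in>P \<inter> Y. \<exists>v\<in>Q \<inter> Y. (u, v) \<in> E'"
          using inside[of Y] PQ(3) by (intro Y.edge_between_parts[OF E' loss]) auto
        then show False using no by blast
      qed
      ultimately have "P \<subseteq> X \<and> Q \<subseteq> Y \<or> Q \<subseteq> X \<and> P \<subseteq> Y" using PQ(1,2,4) by blast
      then show False
      proof
        assume "P \<subseteq> X \<and> Q \<subseteq> Y"
        then have "\<exists>u\<in>P. \<exists>v\<in>Q. (u, v) \<in> E'" using PQ(5) by (intro cross) auto
        then show False using no by contradiction
      next
        assume "Q \<subseteq> X \<and> P \<subseteq> Y"
        moreover have "card (X \<union> Y - (Q \<union> P)) < k" using PQ(5) by (simp add: Un_commute)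
        ultimately obtain u v where "u \<in> Q" "v \<in> P" "(u, v) \<in> E'" using cross[of Q P] by blast
        then show False using no symD[OF E'(1)] by blast
      qed
    qed
  qed
  then show ?thesis using H unfolding E'_def by (intro exI[of _ H] conjI)
qed

section \<open>From a sparse cut to two dense sides\<close>

text \<open>
  Applied with \<open>d\<close> equal to \<open>n / 2\<close> rounded up; the bound \<open>n + 3k + 5 \<le> 3d\<close> is where
  \<open>n \<ge> 6k + 10\<close> is needed, with equality for \<open>n = 6k + 10\<close>.
\<close>

lemma dense_side_of_sparse_cut:
  assumes E: "sym E" "irrefl E" and fin: "finite V"
    and V: "V = X \<union> Y" "X \<inter> Y = {}" and AB: "A \<subseteq> X" "B \<subseteq> Y" "A \<noteq> {}" "B \<noteq> {}"
    and sparse: "\<And>u. u \<in> A \<Longrightarrow> card (nbrs E B u) \<le> 2" "\<And>u. u \<in> B \<Longrightarrow> card (nbrs E A u) \<le> 2"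
    and S: "card (X - A) + card (Y - B) < k"
    and d: "\<And>u. u \<in> V \<Longrightarrow> d \<le> card (nbrs E V u)" "card V \<le> 2 * d" "card V + 3 * k + 5 \<le> 3 * d"
      "3 * k + 5 \<le> d"
    and near: "\<And>u. u \<in> X - A \<Longrightarrow> card (nbrs E B u) \<le> card (nbrs E A u)"
  shows "dense_side E X A k" and "2 * k + 5 \<le> card X"
proof -
  have finite: "finite X" "finite Y" "finite A" "finite B"
    using fin V AB finite_subset by (auto intro: finite_subset)
  have cX: "card X = card A + card (X - A)" and cY: "card Y = card B + card (Y - B)"
    using finite AB by (simp_all add: card_Diff_subset card_mono)
  have cV: "card V = card X + card Y" using V finite by (simp add: card_Un_disjoint)
  have nbrs_V: "card (nbrs E V u) \<le> card (nbrs E A u) + card (nbrs E (X - A) u) +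
      card (nbrs E B u) + card (nbrs E (Y - B) u)" for u
  proof -
    have "V = (A \<union> (X - A)) \<union> (B \<union> (Y - B))" using V AB by auto
    then show ?thesis
      using card_nbrs_Un[of "A \<union> (X - A)" "B \<union> (Y - B)" E u] card_nbrs_Un[of A "X - A" E u]
        card_nbrs_Un[of B "Y - B" E u] finite by (simp del: Un_Diff_cancel)
  qed
  have le: "card (nbrs E Z u) \<le> card Z" if "finite Z" for Z u
    using card_mono[OF that nbrs_subset] .
  \<comment> \<open>A core vertex sees at most its own part without itself, all cut vertices, and
    two vertices of the opposite part; the summand 1 is \<open>2 - 1\<close>.\<close>
  have sizes: "d \<le> card A + card (X - A) + 1 + card (Y - B)"
    "d \<le> card B + card (X - A) + 1 + card (Y - B)"
  proof -
    obtain a b where ab: "a \<in> A" "b \<in> B" using AB by blast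
    show "d \<le> card A + card (X - A) + 1 + card (Y - B)"
      using nbrs_V[of a] d(1)[of a] sparse(1)[OF ab(1)] card_nbrs_less[OF finite(3) E(2) ab(1)]
        le[of "X - A" a] le[of "Y - B" a] ab V AB finite by force
    show "d \<le> card B + card (X - A) + 1 + card (Y - B)"
      using nbrs_V[of b] d(1)[of b] sparse(2)[OF ab(2)] card_nbrs_less[OF finite(4) E(2) ab(2)]
        le[of "X - A" b] le[of "Y - B" b] ab V AB finite by force
  qed
  show "2 * k + 5 \<le> card X" using sizes S d cX by linarith
  have core: "d \<le> card (nbrs E X p) + 2 + card (Y - B)" if "p \<in> A" for p
  proof -
    have "card (nbrs E V p) \<le> card (nbrs E X p) + card (nbrs E Y p)"
      using card_nbrs_Un finite V by metis
    moreover have "card (nbrs E Y p) \<le> card (nbrs E B p) + card (nbrs E (Y - B) p)"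
    proof -
      have "Y = B \<union> (Y - B)" using AB by auto
      then show ?thesis using card_nbrs_Un[of B "Y - B" E p] finite by (metis finite_Diff)
    qed
    moreover have "p \<in> V" using that V AB by auto
    ultimately show ?thesis
      using d(1)[of p] sparse(1)[OF that] le[of "Y - B" p] finite by fastforce
  qed
  show "dense_side E X A k"
  proof
    fix p assume p: "p \<in> A"
    show "card X \<le> card (nbrs E X p) + k + 2"
      using core[OF p] sizes S d cX cY cV by linarith
    \<comment> \<open>The worst case has all \<open>k - 1\<close> cut vertices in
      \<open>Y - B\<close>; it uses \<open>card V + 3 * k + 5 \<le> 3 * d\<close> with
      equality.\<close>
    show "card X + k + 2 \<le> 2 * card (nbrs E X p)"
      using core[OF p] sizes S d cX cY cV by linarith
  next
    fix q assume q: "q \<in> X - A"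
    have "q \<in> V" using q V by auto
    moreover have "card (nbrs E (X - A) q) < card (X - A)"
      using card_nbrs_less q finite E by (metis finite_Diff)
    \<comment> \<open>At most \<open>k - 2\<close> neighbours lie in the cut, and at least half of
      the others lie in \<open>A\<close>. Thus twice their number is at least
      \<open>2 * k + 7\<close>, and rounding up gives \<open>k + 4\<close>.\<close>
    ultimately show "k + 4 \<le> card (nbrs E A q)"
      using nbrs_V[of q] d near[OF q] le[of "Y - B" q] finite S by fastforce
  next
    show "card (X - A) < card A" using sizes S d by linarith
    show "card (X - A) < k" using S by linarith
  qed (use E finite AB in auto)
qed

lemma hamiltonian_cycle_preserving_connectivity:
  fixes E :: "('a \<times> 'a) set"
  assumes E: "sym E" "irrefl E" and n: "6 * k + 10 \<le> card V"
    and deg: "\<And>u. u \<in> V \<Longrightarrow> card V \<le> 2 * card (nbrs E V u)"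
    and cut: "no_small_cut k V E"
  shows "\<exists>xs. ham_cycle E V xs \<and> no_small_cut k V (remove_cycle E xs)"
proof -
  have fin: "finite V" using n by (metis card.infinite add_is_0 le_zero_eq zero_neq_numeral)
  obtain xs where xs: "ham_cycle E V xs" using dirac[OF E _ deg] n by auto
  define E0 where "E0 = remove_cycle E xs"
  show ?thesis
  proof (cases "no_small_cut k V E0")
    case True
    then show ?thesis using xs E0_def by blast
  next
    case False
    then obtain A B where AB: "A \<noteq> {}" "B \<noteq> {}" "A \<inter> B = {}" "A \<union> B \<subseteq> V"
      "card (V - (A \<union> B)) < k" and no: "\<And>u v. u \<in> A \<Longrightarrow> v \<in> B \<Longrightarrow> (u, v) \<notin> E0"
      unfolding no_small_cut_def by blast
    have no': "(v, u) \<notin> E0" if "u \<in> A" "v \<in> B" for u v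
      using no[OF that] sym_remove_cycle[OF E(1), of xs] by (auto simp: E0_def dest: symD)
    have loss: "card (nbrs E W u - nbrs E0 W u) \<le> 2" for W u
      unfolding E0_def by (rule card_nbrs_remove_cycle) (use xs in \<open>simp add: ham_cycle_def\<close>)
    have sparse_A: "card (nbrs E B u) \<le> 2" if "u \<in> A" for u
    proof -
      \<comment> \<open>No edge from \<open>u\<close> to \<open>B\<close> survives, so all of them
        belong to the deleted cycle, which has at most two edges at \<open>u\<close>.\<close>
      have "nbrs E B u - nbrs E0 B u = nbrs E B u" using no[OF that] by auto
      then show ?thesis using loss[of B u] by simp
    qed
    have sparse_B: "card (nbrs E A u) \<le> 2" if "u \<in> B" for u
    proof -
      have "nbrs E A u - nbrs E0 A u = nbrs E A u" using no' that by auto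
      then show ?thesis using loss[of A u] by simp
    qed
    define d where "d = (card V + 1) div 2"
    define S where "S = V - (A \<union> B)"
    \<comment> \<open>Each cut vertex joins the part in which it has more neighbours. Ties go to
      \<open>X\<close>, which is harmless since both sides need only the weak inequality.\<close>
    define X where "X = A \<union> {u \<in> S. card (nbrs E B u) \<le> card (nbrs E A u)}"
    define Y where "Y = V - X"
    have V: "V = X \<union> Y" "V = Y \<union> X" "X \<inter> Y = {}" "Y \<inter> X = {}"
      using AB by (auto simp: X_def Y_def S_def)
    have sub: "A \<subseteq> X" "B \<subseteq> Y" using AB by (auto simp: X_def Y_def S_def)
    have split: "X - A \<union> (Y - B) = S" "(X - A) \<inter> (Y - B) = {}"
      using AB by (auto simp: X_def Y_def S_def)
    have "finite S" using fin by (simp add: S_def)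
    then have "card S = card (X - A) + card (Y - B)"
      using split card_Un_disjoint[of "X - A" "Y - B"] by (metis finite_Un)
    then have small: "card (X - A) + card (Y - B) < k" "card (Y - B) + card (X - A) < k"
      using AB(5) by (simp_all add: S_def)
    have dd: "card V \<le> 2 * d" "card V + 3 * k + 5 \<le> 3 * d" "3 * k + 5 \<le> d" using n by (auto simp: d_def)
    have deg_d: "d \<le> card (nbrs E V u)" if "u \<in> V" for u using deg[OF that] by (simp add: d_def)
    have near_X: "card (nbrs E B u) \<le> card (nbrs E A u)" if "u \<in> X - A" for u
      using that by (auto simp: X_def)
    have near_Y: "card (nbrs E A u) \<le> card (nbrs E B u)" if "u \<in> Y - B" for u
      using that by (auto simp: X_def Y_def S_def)
    note side_X = dense_side_of_sparse_cut[OF E fin V(1,3) sub AB(1,2) sparse_A sparse_B small(1)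
        deg_d dd near_X]
    note side_Y = dense_side_of_sparse_cut[OF E fin V(2,4) sub(2,1) AB(2,1) sparse_B sparse_A small(2)
        deg_d dd near_Y]
    consider "card X \<le> card Y" | "card Y \<le> card X" by linarith
    then show ?thesis
    proof cases
      case 1
      then show ?thesis
        using two_dense_sides[OF side_X(1) side_Y(1) V(3)] side_X(2) cut deg V(1) by auto
    next
      case 2
      then show ?thesis
        using two_dense_sides[OF side_Y(1) side_X(1) V(4)] side_Y(2) cut deg V(2) by auto
    qed
  qed
qed

section \<open>Transfer to \<open>pair_graph\<close> and the stated degree bound\<close>

theorem theorem4:
  fixes G :: "'a pair_pre_digraph" and k n :: nat
  assumes "k \<ge> 2"
    and "pair_graph G"
    and "k_connected k G"
    and "card (pverts G) = n"
    and "real n \<ge> 6 * real k + 12 - 2 * real_of_int \<lceil>(real k - 2) / real k\<rceil>"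
    and "real (min_degree G) \<ge> real n / 2"
  shows "\<exists>p. hamiltonian_cycle G p \<and>
             k_connected k (delete_edges G (undirected_edges (set p)))"
proof -
  interpret pair_graph G by fact
  let ?V = "pverts G" and ?E = "parcs G"
  \<comment> \<open>The ceiling is at most 1, so the order is at least \<open>6 * k + 10\<close> for
    every admissible \<open>k\<close>.\<close>
  have "(real k - 2) / real k \<le> 1" using assms(1) by simp
  then have "\<lceil>(real k - 2) / real k\<rceil> \<le> 1" by (simp add: ceiling_le_iff)
  then have "real n \<ge> 6 * real k + 10" using assms(5) by linarith
  then have n: "6 * k + 10 \<le> card ?V" using assms(4) by linarith
  have E: "sym ?E" "irrefl ?E"
    using pair_sym_arcs pair_no_loops[of "(_, _)"] by (auto simp: symmetric_def irrefl_def)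
  have deg: "card ?V \<le> 2 * card (nbrs ?E ?V u)" if "u \<in> ?V" for u
  proof -
    have "min_degree G \<le> out_degree (with_proj G) u"
      unfolding min_degree_def by (rule Min_le) (use that pair_finite_verts in auto)
    also have "out_arcs (with_proj G) u = Pair u ` nbrs ?E ?V u"
      using in_arcsD2 by (auto simp: out_arcs_def)
    then have "out_degree (with_proj G) u = card (nbrs ?E ?V u)"
      by (simp add: out_degree_def card_image inj_on_def)
    finally show ?thesis using assms(4,6) by linarith
  qed
  have "no_small_cut k ?V ?E"
    using k_connected_iff_no_small_cut[of G k] pair_finite_verts E(1) n assms(3) by simp
  then obtain xs where xs: "ham_cycle ?E ?V xs" "no_small_cut k ?V (remove_cycle ?E xs)"
    using hamiltonian_cycle_preserving_connectivity[OF E n deg] by blast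
  let ?p = "cycle_arcs xs" and ?G' = "delete_edges G (undirected_edges (set (cycle_arcs xs)))"
  \<comment> \<open>Deleting an undirected edge removes both of its arcs, which is why
    \<open>remove_cycle\<close> also subtracts the converse.\<close>
  have "parcs ?G' = remove_cycle ?E xs"
    by (force simp: delete_edges_def undirected_edges_def remove_cycle_def doubleton_eq_iff)
  moreover have "pverts ?G' = ?V" by (simp add: delete_edges_def)
  ultimately have "k_connected k ?G'"
    using k_connected_iff_no_small_cut[of ?G' k] pair_finite_verts n xs(2)
      sym_remove_cycle[OF E(1)] by simp
  moreover have "hamiltonian_cycle G ?p"
    using hamiltonian_cycle_cycle_arcs[OF xs(1)] n by simp
  ultimately show ?thesis by blast
qed

end
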